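(* For all integers $k\ge0$, \[ T_k(t,q)=\sum_{\nu \in \mathcal{SOP}(k)} (-1)^{\mathrm{diag}(\nu)+\left\lfloor \mathrm{mark}(\nu)/2\right\rfloor}\, t^{\mathrm{mark}(\nu)}\, q^{|\nu|}. \]
   Context: The polynomials $T_k(t,q)$ in the indeterminates $t,q$ are defined by $T_0(t,q)=1$ and, for $k\ge1$, \[ T_k(t,q) = T_{k-1}(t,q) + (1+t)(-q)^{k^2} + (1-t^2) \sum_{i=1}^{k-1} (-q)^{k^2-i^2}\, T_{i-1}(t,q). \] Partitions are identified with their Ferrers diagrams: left-justified rows of cells, the $i$-th row from the top having $\lambda_i$ cells; the $(i,j)$-cell is the cell in row $i$ and column $j$. An inner corner of a partition $\lambda$ is a cell $c\in\lambda$ such that $\lambda\setminus\{c\}$ is a partition. An overpartition is a partition in which each inner corner may or may not be marked. Its conjugate is obtained by transposing the underlying partition, the $(i,j)$-cell being marked in the conjugate if and only if the $(j,i)$-cell is marked in the original. A self-conjugate overpartition is one equal to its conjugate. $\mathcal{SOP}(k)$ is the set of self-conjugate overpartitions whose underlying partition is contained in the $k\times k$ box (at most $k$ parts, each at most $k$). For an overpartition $\nu$: $|\nu|$ is the number of cells, $\mathrm{diag}(\nu)$ is the number of cells of the form $(i,i)$ in $\nu$, and $\mathrm{mark}(\nu)$ is the number of marked cells. *)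

theory Defs
  imports "HOL-Computational_Algebra.Polynomial"
begin

text \<open>
  The ring \<open>\<int>[t, q]\<close> is rendered as \<open>\<int>[t][q]\<close>: the outer variable is \<open>q\<close>, the inner one
  is \<open>t\<close>.
\<close>

definition var_t :: "int poly poly" where
  "var_t = [:[:0, 1:]:]"

definition var_q :: "int poly poly" where
  "var_q = [:0, 1:]"

declare sum.cong [fundef_cong]

fun T_poly :: "nat \<Rightarrow> int poly poly" where
  "T_poly 0 = 1"
| "T_poly (Suc n) =
     T_poly n + (1 + var_t) * (- var_q) ^ ((Suc n)\<^sup>2)
     + (1 - var_t\<^sup>2) * (\<Sum>i = 1..n. (- var_q) ^ ((Suc n)\<^sup>2 - i\<^sup>2) * T_poly (i - 1))"

lemma T_poly_rec:
  assumes "k \<ge> 1"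
  shows "T_poly k =
     T_poly (k - 1) + (1 + var_t) * (- var_q) ^ (k\<^sup>2)
     + (1 - var_t\<^sup>2) * (\<Sum>i = 1..k - 1. (- var_q) ^ (k\<^sup>2 - i\<^sup>2) * T_poly (i - 1))"
  using assms by (cases k) simp_all

text \<open>Cells are pairs (row, column), both numbered from 1; list positions are numbered from 0.\<close>

type_synonym cell = "nat \<times> nat"

definition ferrers :: "nat list \<Rightarrow> cell set" where
  "ferrers xs = {(i, j). 1 \<le> i \<and> i \<le> length xs \<and> 1 \<le> j \<and> j \<le> xs ! (i - 1)}"

text \<open>Partitions are identified with their Ferrers diagrams.\<close>

definition partitions :: "cell set set" where
  "partitions = {ferrers xs | xs. sorted_wrt (\<ge>) xs \<and> (\<forall>x \<in> set xs. 0 < x)}"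

definition inner_corners :: "cell set \<Rightarrow> cell set" where
  "inner_corners D = {c \<in> D. D - {c} \<in> partitions}"

text \<open>An overpartition is a pair (underlying partition, set of marked cells).\<close>

type_synonym overpartition = "cell set \<times> cell set"

definition overpartitions :: "overpartition set" where
  "overpartitions = {(D, M). D \<in> partitions \<and> M \<subseteq> inner_corners D}"

definition conjugate :: "overpartition \<Rightarrow> overpartition" where
  "conjugate \<nu> = (prod.swap ` fst \<nu>, prod.swap ` snd \<nu>)"

definition SOP :: "nat \<Rightarrow> overpartition set" where
  "SOP k = {\<nu> \<in> overpartitions. conjugate \<nu> = \<nu> \<and> fst \<nu> \<subseteq> {1..k} \<times> {1..k}}"

definition num_cells :: "overpartition \<Rightarrow> nat" where
  "num_cells \<nu> = card (fst \<nu>)"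

definition diag :: "overpartition \<Rightarrow> nat" where
  "diag \<nu> = card {i. (i, i) \<in> fst \<nu>}"

definition mark :: "overpartition \<Rightarrow> nat" where
  "mark \<nu> = card (snd \<nu>)"

lemma finite_SOP: "finite (SOP k)"
proof (rule finite_subset)
  show "SOP k \<subseteq> Pow ({1..k} \<times> {1..k}) \<times> Pow ({1..k} \<times> {1..k})"
    by (auto simp: SOP_def overpartitions_def inner_corners_def subset_iff)
qed simp

end

theory Submission
  imports Defs
begin

text \<open>
  A self-conjugate overpartition in the \<open>k \<times> k\<close> box either lies in the \<open>(k - 1) \<times> (k - 1)\<close> box,
  or is the full box, whose only inner corner \<open>(k, k)\<close> may be marked, or has exactly \<open>m\<close> rows of
  length \<open>k\<close> with \<open>1 \<le> m < k\<close>. In the last case the inner corners \<open>(m, k)\<close> and \<open>(k, m)\<close> are marked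
  together or not at all, and removing the first \<open>m\<close> rows and columns leaves an arbitrary
  self-conjugate overpartition in the box of size \<open>k - m - 1\<close>. With \<open>i = k - m\<close> the three cases give
  the three terms of the recurrence of \<open>T\<^sub>k\<close>.
\<close>

section \<open>Partitions as finite down-closed sets of cells\<close>

definition down_closed :: "cell set \<Rightarrow> bool" where
  "down_closed D \<longleftrightarrow> (\<forall>a b a' b'. (a, b) \<in> D \<longrightarrow> 1 \<le> a' \<longrightarrow> a' \<le> a \<longrightarrow> 1 \<le> b' \<longrightarrow> b' \<le> b \<longrightarrow> (a', b') \<in> D)"

lemma down_closedD:
  "down_closed D \<Longrightarrow> (a, b) \<in> D \<Longrightarrow> 1 \<le> a' \<Longrightarrow> a' \<le> a \<Longrightarrow> 1 \<le> b' \<Longrightarrow> b' \<le> b \<Longrightarrow> (a', b') \<in> D"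
  unfolding down_closed_def by blast

text \<open>Closure fills everything from 1 up to the maximum. This is applied to the rows and the
  first column of a diagram, and later to the last column of the box.\<close>

lemma initial_segment_eq_atLeastAtMost_card:
  fixes X :: "nat set"
  assumes "finite X" "0 \<notin> X" "\<And>x y. x \<in> X \<Longrightarrow> 1 \<le> y \<Longrightarrow> y \<le> x \<Longrightarrow> y \<in> X"
  shows "X = {1..card X}"
proof (cases "X = {}")
  case False
  have "X = {1..Max X}"
  proof (intro equalityI subsetI)
    fix x assume "x \<in> X"
    then show "x \<in> {1..Max X}"
      using assms(1,2) by (cases x) auto
  next
    fix x assume "x \<in> {1..Max X}"
    then show "x \<in> X"
      using assms(3)[of "Max X" x] Max_in[OF assms(1) False] by auto
  qed
  then show ?thesis
    by (metis card_atLeastAtMost diff_Suc_1)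
qed simp

text \<open>The list of parts can be recovered from the row lengths of the diagram. The right-hand
  side is a condition on cells alone, which is easy to check after a translation or a removal of
  cells.\<close>

lemma partitions_iff:
  "D \<in> partitions \<longleftrightarrow> finite D \<and> D \<subseteq> {1..} \<times> {1..} \<and> down_closed D"
proof
  assume "D \<in> partitions"
  then obtain xs where D: "D = ferrers xs" and s: "sorted_wrt (\<ge>) xs"
    by (auto simp: partitions_def)
  \<comment> \<open>Inserting 0 keeps \<open>Max\<close> meaningful for the empty partition.\<close>
  have "D \<subseteq> {1..length xs} \<times> {1..Max (insert 0 (set xs))}"
  proof (clarsimp simp: D ferrers_def)
    fix a b assume "Suc 0 \<le> a" "a \<le> length xs" "b \<le> xs ! (a - Suc 0)"
    moreover from this have "xs ! (a - Suc 0) \<in> set xs" by (intro nth_mem) auto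
    ultimately show "b \<le> Max (insert 0 (set xs))"
      by (meson List.finite_set Max_ge finite.insertI insertI2 le_trans)
  qed
  then have "finite D" by (rule finite_subset) simp
  moreover have "D \<subseteq> {1..} \<times> {1..}" by (auto simp: D ferrers_def)
  moreover have "down_closed D"
    unfolding down_closed_def
  proof (intro allI impI)
    fix a b a' b' assume *: "(a, b) \<in> D" "1 \<le> a'" "a' \<le> a" "1 \<le> b'" "b' \<le> b"
    have "xs ! (a - 1) \<le> xs ! (a' - 1)"
    proof (cases "a' = a")
      case False
      then show ?thesis
        using * sorted_wrt_nth_less[OF s, of "a' - 1" "a - 1"] by (auto simp: D ferrers_def)
    qed simp
    then show "(a', b') \<in> D" using * by (auto simp: D ferrers_def)
  qed
  ultimately show "finite D \<and> D \<subseteq> {1..} \<times> {1..} \<and> down_closed D" by blast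
next
  assume asm: "finite D \<and> D \<subseteq> {1..} \<times> {1..} \<and> down_closed D"
  \<comment> \<open>Rows and the first column are initial segments, so their cardinalities are the
    parts and the number of parts.\<close>
  define row where "row a = {b. (a, b) \<in> D}" for a
  define col where "col = {a. (a, 1) \<in> D}"
  have fin_row: "finite (row a)" for a
    using asm finite_subset[of "row a" "snd ` D"] by (force simp: row_def)
  have fin_col: "finite col"
    using asm finite_subset[of col "fst ` D"] by (force simp: col_def)
  have row: "row a = {1..card (row a)}" for a
  proof (rule initial_segment_eq_atLeastAtMost_card[OF fin_row])
    show "0 \<notin> row a" using asm by (auto simp: row_def)
    show "y \<in> row a" if "x \<in> row a" "1 \<le> y" "y \<le> x" for x y
      using that asm down_closedD[of D a x a y] by (auto simp: row_def)
  qed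
  have col: "col = {1..card col}"
  proof (rule initial_segment_eq_atLeastAtMost_card[OF fin_col])
    show "0 \<notin> col" using asm by (auto simp: col_def)
    show "y \<in> col" if "x \<in> col" "1 \<le> y" "y \<le> x" for x y
      using that asm down_closedD[of D x 1 y 1] by (auto simp: col_def)
  qed
  \<comment> \<open>List positions start at 0 and rows at 1, hence \<open>Suc a\<close>.\<close>
  define xs where "xs = map (\<lambda>a. card (row (Suc a))) [0..<card col]"
  have mem: "(a, b) \<in> D \<longleftrightarrow> a \<in> {1..card col} \<and> b \<in> {1..card (row a)}" for a b
  proof -
    have "a \<in> col" if "(a, b) \<in> D"
      using that asm down_closedD[of D a b a 1] by (auto simp: col_def)
    then show ?thesis using row[of a] col by (auto simp: row_def)
  qed
  have "D = ferrers xs"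
    by (auto simp: ferrers_def xs_def mem)
  moreover have "sorted_wrt (\<ge>) xs"
  proof -
    have "card (row (Suc b)) \<le> card (row (Suc a))" if "a < b" for a b
    proof (rule card_mono[OF fin_row])
      show "row (Suc b) \<subseteq> row (Suc a)"
        using that asm down_closedD[of D "Suc b" _ "Suc a"] by (fastforce simp: row_def)
    qed
    then show ?thesis by (auto simp: sorted_wrt_iff_nth_less xs_def)
  qed
  moreover have "0 < x" if x: "x \<in> set xs" for x
  proof -
    obtain a where a: "a < card col" "x = card (row (Suc a))"
      using x by (auto simp: xs_def)
    then have "Suc a \<in> {1..card col}" by simp
    then have "Suc a \<in> col" using col by blast
    then have "row (Suc a) \<noteq> {}" by (auto simp: col_def row_def)
    then show ?thesis using a fin_row by (simp add: card_gt_0_iff)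
  qed
  ultimately show "D \<in> partitions" by (auto simp: partitions_def)
qed

text \<open>Removing a cell that has a neighbour below or to the right destroys down-closedness.
  Conversely, any other cell of \<open>D\<close> weakly below and to the right of
  \<open>(a, b)\<close> would force one of these two neighbours into \<open>D\<close>.\<close>

lemma inner_corners_iff:
  assumes "D \<in> partitions"
  shows "(a, b) \<in> inner_corners D \<longleftrightarrow> (a, b) \<in> D \<and> (Suc a, b) \<notin> D \<and> (a, Suc b) \<notin> D"
proof -
  have D: "finite D" "D \<subseteq> {1..} \<times> {1..}" "down_closed D"
    using assms by (auto simp: partitions_iff)
  show ?thesis
  proof
    assume "(a, b) \<in> inner_corners D"
    then have "(a, b) \<in> D" and *: "down_closed (D - {(a, b)})"
      by (auto simp: inner_corners_def partitions_iff)
    then have "1 \<le> a" "1 \<le> b" using D by auto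
    then show "(a, b) \<in> D \<and> (Suc a, b) \<notin> D \<and> (a, Suc b) \<notin> D"
      using \<open>(a, b) \<in> D\<close> down_closedD[OF *, of "Suc a" b a b] down_closedD[OF *, of a "Suc b" a b]
      by auto
  next
    assume *: "(a, b) \<in> D \<and> (Suc a, b) \<notin> D \<and> (a, Suc b) \<notin> D"
    then have ab: "1 \<le> a" "1 \<le> b" using D by auto
    have "down_closed (D - {(a, b)})"
      unfolding down_closed_def
    proof (intro allI impI)
      fix c d c' d' assume **: "(c, d) \<in> D - {(a, b)}" "1 \<le> c'" "c' \<le> c" "1 \<le> d'" "d' \<le> d"
      have "(c', d') \<noteq> (a, b)"
      proof
        assume "(c', d') = (a, b)"
        then have "Suc a \<le> c \<and> b \<le> d \<or> a \<le> c \<and> Suc b \<le> d"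
          using ** by auto
        then show False
          using * ** ab down_closedD[OF D(3), of c d "Suc a" b]
            down_closedD[OF D(3), of c d a "Suc b"] by auto
      qed
      then show "(c', d') \<in> D - {(a, b)}"
        using ** down_closedD[OF D(3), of c d c' d'] by auto
    qed
    then show "(a, b) \<in> inner_corners D"
      using * D by (auto simp: inner_corners_def partitions_iff)
  qed
qed

section \<open>Self-conjugate overpartitions in coordinates\<close>

lemma swap_image_eq_iff: "prod.swap ` X = X \<longleftrightarrow> (\<forall>a b. (a, b) \<in> X \<longrightarrow> (b, a) \<in> X)"
proof -
  have "(a, b) \<in> prod.swap ` X \<longleftrightarrow> (b, a) \<in> X" for a b
    by (force simp: image_iff)
  then show ?thesis by (auto simp: set_eq_iff)
qed

text \<open>The box supplies finiteness and positive coordinates, so being a partition reduces to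
  down-closedness. Transposition is an involution, so one implication expresses symmetry.\<close>

lemma SOP_iff:
  "(D, M) \<in> SOP k \<longleftrightarrow> D \<subseteq> {1..k} \<times> {1..k} \<and> down_closed D \<and> (\<forall>a b. (a, b) \<in> D \<longrightarrow> (b, a) \<in> D) \<and>
     (\<forall>a b. (a, b) \<in> M \<longrightarrow> (a, b) \<in> D \<and> (Suc a, b) \<notin> D \<and> (a, Suc b) \<notin> D \<and> (b, a) \<in> M)"
proof -
  have part: "D \<in> partitions \<longleftrightarrow> down_closed D" if "D \<subseteq> {1..k} \<times> {1..k}"
    using that finite_subset[OF that] by (force simp: partitions_iff)
  show ?thesis
  proof (cases "D \<subseteq> {1..k} \<times> {1..k} \<and> D \<in> partitions")
    case True
    then have "M \<subseteq> inner_corners D \<longleftrightarrow>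
        (\<forall>a b. (a, b) \<in> M \<longrightarrow> (a, b) \<in> D \<and> (Suc a, b) \<notin> D \<and> (a, Suc b) \<notin> D)"
      using inner_corners_iff by auto
    then show ?thesis
      using True part
      by (auto simp: SOP_def overpartitions_def conjugate_def swap_image_eq_iff)
  next
    case False
    then show ?thesis using part by (auto simp: SOP_def overpartitions_def)
  qed
qed

section \<open>Adding and removing the full rows and columns\<close>

definition weight :: "overpartition \<Rightarrow> int poly poly" where
  "weight \<nu> = (-1) ^ (diag \<nu> + mark \<nu> div 2) * var_t ^ mark \<nu> * var_q ^ num_cells \<nu>"

definition shift_cell :: "nat \<Rightarrow> cell \<Rightarrow> cell" where
  "shift_cell m c = (fst c + m, snd c + m)"

text \<open>The L-shaped union of the first \<open>m\<close> rows and the first \<open>m\<close>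
  columns of the box. As a difference of squares it visibly has
  \<open>k\<^sup>2 - (k - m)\<^sup>2\<close> cells, an exponent of the recurrence.\<close>

definition border :: "nat \<Rightarrow> nat \<Rightarrow> cell set" where
  "border m k = {1..k} \<times> {1..k} - {Suc m..k} \<times> {Suc m..k}"

text \<open>The Boolean tells whether the new pair of corners is marked; self-conjugacy allows only
  both or neither.\<close>

definition extend :: "nat \<Rightarrow> nat \<Rightarrow> overpartition \<times> bool \<Rightarrow> overpartition" where
  "extend m k = (\<lambda>((D, M), s).
     (border m k \<union> shift_cell m ` D, shift_cell m ` M \<union> (if s then {(m, k), (k, m)} else {})))"

text \<open>The lower bounds discard row and column \<open>m\<close>, which would become row and
  column 0; this also drops the marks on \<open>(m, k)\<close> and \<open>(k, m)\<close>.\<close>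

definition unshift :: "nat \<Rightarrow> cell set \<Rightarrow> cell set" where
  "unshift m X = {(a, b). 1 \<le> a \<and> 1 \<le> b \<and> (a + m, b + m) \<in> X}"

text \<open>For \<open>1 \<le> m\<close>, down-closedness turns these two conditions into: the last
  column has height \<open>m\<close>, that is, exactly \<open>m\<close> rows have length
  \<open>k\<close>.\<close>

definition SOP_border :: "nat \<Rightarrow> nat \<Rightarrow> overpartition set" where
  "SOP_border m k = {\<nu> \<in> SOP k. (m, k) \<in> fst \<nu> \<and> (Suc m, k) \<notin> fst \<nu>}"

lemma mem_shift_cell_image:
  "(a, b) \<in> shift_cell m ` X \<longleftrightarrow> m \<le> a \<and> m \<le> b \<and> (a - m, b - m) \<in> X"
  by (force simp: shift_cell_def image_iff)

lemma card_shift_cell_image: "card (shift_cell m ` X) = card X"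
  by (intro card_image inj_onI) (auto simp: shift_cell_def prod_eq_iff)

lemma SOP_bounds:
  assumes "(D, M) \<in> SOP k"
  shows "D \<subseteq> {1..k} \<times> {1..k}" "M \<subseteq> D" "finite D" "finite M"
proof -
  show D: "D \<subseteq> {1..k} \<times> {1..k}" and M: "M \<subseteq> D"
    using assms by (auto simp: SOP_iff)
  show "finite D" by (rule finite_subset[OF D]) simp
  then show "finite M" using M by (rule rev_finite_subset)
qed

text \<open>The box size \<open>k - m - 1\<close>, rather than \<open>k - m\<close>, keeps the
  translated diagram out of the last row and column. Hence \<open>(m, k)\<close> and
  \<open>(k, m)\<close> are inner corners.\<close>

lemma extend_in_SOP_border:
  assumes m: "1 \<le> m" "m < k" and \<nu>: "(D, M) \<in> SOP (k - m - 1)"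
  shows "extend m k ((D, M), s) \<in> SOP_border m k"
proof -
  define E where "E = border m k \<union> shift_cell m ` D"
  define N where "N = shift_cell m ` M \<union> (if s then {(m, k), (k, m)} else {})"
  have box: "\<And>a b. (a, b) \<in> D \<Longrightarrow> 1 \<le> a \<and> 1 \<le> b \<and> a \<le> k - m - 1 \<and> b \<le> k - m - 1"
    using SOP_bounds(1)[OF \<nu>] by auto
  have dc: "down_closed D" and sym: "\<And>a b. (a, b) \<in> D \<Longrightarrow> (b, a) \<in> D"
    and M: "\<And>a b. (a, b) \<in> M \<Longrightarrow> (a, b) \<in> D \<and> (Suc a, b) \<notin> D \<and> (a, Suc b) \<notin> D \<and> (b, a) \<in> M"
    using \<nu> by (auto simp: SOP_iff)
  \<comment> \<open>The inequalities for the translated part are strict because cells of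
    \<open>D\<close> have positive coordinates.\<close>
  have E: "(a, b) \<in> E \<longleftrightarrow> 1 \<le> a \<and> 1 \<le> b \<and> a \<le> k \<and> b \<le> k \<and> (a \<le> m \<or> b \<le> m)
      \<or> m < a \<and> m < b \<and> (a - m, b - m) \<in> D" for a b
    using box[of "a - m" "b - m"] unfolding E_def border_def
    by (auto simp: mem_shift_cell_image)
  have Ebox: "(a, b) \<in> E \<Longrightarrow> 1 \<le> a \<and> 1 \<le> b \<and> a \<le> k \<and> b \<le> k" for a b
    using box[of "a - m" "b - m"] by (auto simp: E)
  have N: "(a, b) \<in> N \<longleftrightarrow> m < a \<and> m < b \<and> (a - m, b - m) \<in> M
      \<or> s \<and> ((a, b) = (m, k) \<or> (a, b) = (k, m))" for a b
    using box[of "a - m" "b - m"] M[of "a - m" "b - m"] unfolding N_def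
    by (auto simp: mem_shift_cell_image)
  have "down_closed E"
    unfolding down_closed_def
  proof (intro allI impI)
    fix a b a' b' assume *: "(a, b) \<in> E" "1 \<le> a'" "a' \<le> a" "1 \<le> b'" "b' \<le> b"
    show "(a', b') \<in> E"
    \<comment> \<open>A cell beyond the border is handled by closure of \<open>D\<close>; otherwise
      it lies in the border, which is full.\<close>
    proof (cases "m < a' \<and> m < b'")
      case True
      then have "m < a" "m < b" "(a - m, b - m) \<in> D" using * by (auto simp: E)
      then have "(a' - m, b' - m) \<in> D"
        using * True down_closedD[OF dc, of "a - m" "b - m" "a' - m" "b' - m"] by auto
      then show ?thesis using True by (auto simp: E)
    next
      case False
      then show ?thesis using *(2-5) Ebox[OF *(1)] unfolding E by linarith
    qed
  qed
  moreover have "(b, a) \<in> E" if "(a, b) \<in> E" for a b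
    using that sym[of "a - m" "b - m"] unfolding E by blast
  \<comment> \<open>These cells would come from \<open>(1, k - m)\<close> and
    \<open>(k - m, 1)\<close>, just outside the smaller box.\<close>
  moreover have corner: "(Suc m, k) \<notin> E" "(k, Suc m) \<notin> E"
    using box[of 1 "k - m"] box[of "k - m" 1] m by (auto simp: E)
  moreover have "(m, k) \<in> E" "(k, m) \<in> E" using m by (auto simp: E)
  moreover have "(a, b) \<in> E \<and> (Suc a, b) \<notin> E \<and> (a, Suc b) \<notin> E \<and> (b, a) \<in> N"
    if "(a, b) \<in> N" for a b
    using that[unfolded N]
  proof
    assume *: "m < a \<and> m < b \<and> (a - m, b - m) \<in> M"
    then show ?thesis
      using M[of "a - m" "b - m"] by (auto simp: E N Suc_diff_le)
  next
    assume *: "s \<and> ((a, b) = (m, k) \<or> (a, b) = (k, m))"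
    then show ?thesis
      using corner \<open>(m, k) \<in> E\<close> \<open>(k, m) \<in> E\<close> Ebox[of "Suc k" m] Ebox[of m "Suc k"]
      by (auto simp: N)
  qed
  moreover have "E \<subseteq> {1..k} \<times> {1..k}" using Ebox by auto
  ultimately have "(E, N) \<in> SOP_border m k"
    by (auto simp: SOP_border_def SOP_iff)
  then show ?thesis by (simp add: extend_def E_def N_def)
qed

text \<open>Translated marks have both coordinates above \<open>m\<close>, so they cannot be
  confused with \<open>(m, k)\<close> or \<open>(k, m)\<close>; the Boolean can be read off at
  \<open>(m, k)\<close>.\<close>

lemma unshift_extend:
  assumes m: "1 \<le> m" "m < k" and \<nu>: "(D, M) \<in> SOP (k - m - 1)"
    and ext: "extend m k ((D, M), s) = (E, N)"
  shows "unshift m E = D" "unshift m N = M" "(m, k) \<in> N \<longleftrightarrow> s"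
proof -
  note b = SOP_bounds(1,2)[OF \<nu>]
  have E: "E = border m k \<union> shift_cell m ` D"
    and N: "N = shift_cell m ` M \<union> (if s then {(m, k), (k, m)} else {})"
    using ext by (auto simp: extend_def)
  show "unshift m E = D"
    using b by (auto simp: E unshift_def border_def mem_shift_cell_image)
  show "unshift m N = M"
    using b by (auto simp: N unshift_def mem_shift_cell_image)
  show "(m, k) \<in> N \<longleftrightarrow> s"
    using b by (auto simp: N mem_shift_cell_image)
qed

lemma extend_unshift:
  assumes m: "1 \<le> m" "m < k" and \<nu>: "(E, N) \<in> SOP_border m k"
  shows "(unshift m E, unshift m N) \<in> SOP (k - m - 1)"
    and "extend m k ((unshift m E, unshift m N), (m, k) \<in> N) = (E, N)"
proof -
  have SOP: "(E, N) \<in> SOP k" and c: "(m, k) \<in> E" "(Suc m, k) \<notin> E"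
    using \<nu> by (auto simp: SOP_border_def)
  have box: "\<And>a b. (a, b) \<in> E \<Longrightarrow> 1 \<le> a \<and> 1 \<le> b \<and> a \<le> k \<and> b \<le> k"
    using SOP_bounds(1)[OF SOP] by auto
  have dc: "down_closed E" and sym: "\<And>a b. (a, b) \<in> E \<Longrightarrow> (b, a) \<in> E"
    and N: "\<And>a b. (a, b) \<in> N \<Longrightarrow> (a, b) \<in> E \<and> (Suc a, b) \<notin> E \<and> (a, Suc b) \<notin> E \<and> (b, a) \<in> N"
    using SOP by (auto simp: SOP_iff)
  have c': "(k, m) \<in> E" using sym c by blast
  \<comment> \<open>A cell of the last row in a column beyond \<open>m\<close> would force
    \<open>(k, Suc m)\<close>, whose mirror image is absent by assumption.\<close>
  have less: "a < k" if "(a, b) \<in> E" "m < b" for a b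
  proof (rule ccontr)
    assume "\<not> a < k"
    then have "(k, Suc m) \<in> E"
      using that m box[OF that(1)] by (intro down_closedD[OF dc that(1)]) auto
    then show False using sym c by blast
  qed
  \<comment> \<open>The first \<open>m\<close> rows are full, so a cell there has a right neighbour
    if \<open>b < k\<close> and a lower neighbour if \<open>a < m\<close>.\<close>
  have marks: "(a, b) = (m, k)" if "(a, b) \<in> N" "a \<le> m" for a b
  proof -
    note n = N[OF that(1)]
    then have ab: "1 \<le> a" "1 \<le> b" "b \<le> k" using box by blast+
    have "b = k"
      using n ab that(2) m down_closedD[OF dc c(1), of a "Suc b"] by (cases "b = k") auto
    moreover have "a = m"
      using n ab that(2) m \<open>b = k\<close> down_closedD[OF dc c(1), of "Suc a" k] by (cases "a = m") auto
    ultimately show ?thesis by simp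
  qed
  have marks': "(a, b) = (k, m)" if "(a, b) \<in> N" "b \<le> m" for a b
    using marks[of b a] that N by auto
  have "unshift m E \<subseteq> {1..k - m - 1} \<times> {1..k - m - 1}"
  proof clarify
    fix a b assume "(a, b) \<in> unshift m E"
    then show "a \<in> {1..k - m - 1} \<and> b \<in> {1..k - m - 1}"
      using less[of "a + m" "b + m"] less[of "b + m" "a + m"] sym[of "a + m" "b + m"]
      by (auto simp: unshift_def)
  qed
  moreover have "down_closed (unshift m E)"
    unfolding down_closed_def
  proof (intro allI impI)
    fix a b a' b' assume *: "(a, b) \<in> unshift m E" "1 \<le> a'" "a' \<le> a" "1 \<le> b'" "b' \<le> b"
    then show "(a', b') \<in> unshift m E"
      using down_closedD[OF dc, of "a + m" "b + m" "a' + m" "b' + m"] by (auto simp: unshift_def)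
  qed
  ultimately show "(unshift m E, unshift m N) \<in> SOP (k - m - 1)"
    using sym N by (auto simp: SOP_iff unshift_def)
  have "border m k \<union> shift_cell m ` unshift m E = E"
  proof (intro set_eqI, clarify)
    fix a b
    \<comment> \<open>The border is the union of the rectangles with lower right cells
      \<open>(k, m)\<close> and \<open>(m, k)\<close>, both of which belong to
      \<open>E\<close>.\<close>
    have "(a, b) \<in> E" if "1 \<le> a" "a \<le> k" "1 \<le> b" "b \<le> m"
      using that m by (intro down_closedD[OF dc c']) auto
    moreover have "(a, b) \<in> E" if "1 \<le> a" "a \<le> m" "1 \<le> b" "b \<le> k"
      using that m by (intro down_closedD[OF dc c(1)]) auto
    moreover have "(a, b) \<in> border m k \<union> shift_cell m ` unshift m E \<longleftrightarrow>
        1 \<le> a \<and> 1 \<le> b \<and> a \<le> k \<and> b \<le> k \<and> (a \<le> m \<or> b \<le> m) \<or> m < a \<and> m < b \<and> (a, b) \<in> E"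
      by (auto simp: border_def mem_shift_cell_image unshift_def)
    ultimately show "(a, b) \<in> border m k \<union> shift_cell m ` unshift m E \<longleftrightarrow> (a, b) \<in> E"
      using box[of a b] not_le by blast
  qed
  moreover have "shift_cell m ` unshift m N \<union> (if (m, k) \<in> N then {(m, k), (k, m)} else {}) = N"
  proof (intro set_eqI, clarify)
    fix a b
    have "(a, b) \<in> shift_cell m ` unshift m N \<longleftrightarrow> m < a \<and> m < b \<and> (a, b) \<in> N"
      by (auto simp: mem_shift_cell_image unshift_def)
    moreover have "(k, m) \<in> N" if "(m, k) \<in> N" using N that by blast
    ultimately show "(a, b) \<in> shift_cell m ` unshift m N \<union> (if (m, k) \<in> N then {(m, k), (k, m)} else {})
        \<longleftrightarrow> (a, b) \<in> N"
      using marks[of a b] marks'[of a b] N[of a b] not_le by auto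
  qed
  ultimately show "extend m k ((unshift m E, unshift m N), (m, k) \<in> N) = (E, N)"
    by (simp add: extend_def)
qed

text \<open>The border adds \<open>m\<close> diagonal cells, and its size has the parity of
  \<open>m\<close>, so the new sign is absorbed into the power of \<open>- var_q\<close>. Two extra
  marks raise \<open>mark div 2\<close> by exactly one, whatever the parity of \<open>mark\<close>,
  which gives the factor \<open>- (var_t\<^sup>2)\<close>.\<close>

lemma weight_extend:
  assumes m: "1 \<le> m" "m < k" and \<nu>: "(D, M) \<in> SOP (k - m - 1)"
  shows "weight (extend m k ((D, M), s)) =
    (- var_q) ^ (k\<^sup>2 - (k - m)\<^sup>2) * weight (D, M) * (if s then - (var_t\<^sup>2) else 1)"
proof -
  note b = SOP_bounds[OF \<nu>]
  define E where "E = border m k \<union> shift_cell m ` D"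
  define N where "N = shift_cell m ` M \<union> (if s then {(m, k), (k, m)} else {})"
  have "card (border m k) = k\<^sup>2 - (k - m)\<^sup>2"
    unfolding border_def by (subst card_Diff_subset) (auto simp: power2_eq_square)
  moreover have "border m k \<inter> shift_cell m ` D = {}"
    using b(1) by (auto simp: border_def shift_cell_def)
  ultimately have cells: "card E = k\<^sup>2 - (k - m)\<^sup>2 + card D"
    unfolding E_def using b(3)
    by (subst card_Un_disjoint) (auto simp: card_shift_cell_image border_def)
  have "{i. (i, i) \<in> E} = {1..m} \<union> (\<lambda>i. i + m) ` {i. (i, i) \<in> D}"
  proof (intro set_eqI)
    fix i
    have "i \<in> (\<lambda>i. i + m) ` {i. (i, i) \<in> D} \<longleftrightarrow> m \<le> i \<and> (i - m, i - m) \<in> D"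
      by (force simp: image_iff)
    then show "i \<in> {i. (i, i) \<in> E} \<longleftrightarrow> i \<in> {1..m} \<union> (\<lambda>i. i + m) ` {i. (i, i) \<in> D}"
      using m b(1) by (auto simp: E_def border_def mem_shift_cell_image)
  qed
  moreover have "finite {i. (i, i) \<in> D}"
    by (rule finite_subset[of _ "{1..k - m - 1}"]) (use b(1) in auto)
  moreover have "{1..m} \<inter> (\<lambda>i. i + m) ` {i. (i, i) \<in> D} = {}"
    using b(1) by auto
  ultimately have dia: "card {i. (i, i) \<in> E} = m + card {i. (i, i) \<in> D}"
    by (simp add: card_Un_disjoint card_image)
  have "shift_cell m ` M \<inter> {(m, k), (k, m)} = {}"
    using b(1,2) by (auto simp: mem_shift_cell_image)
  \<comment> \<open>Since \<open>m < k\<close>, the two corners are distinct and count as two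
    marks.\<close>
  then have marks: "card N = card M + (if s then 2 else 0)"
    unfolding N_def using b(4) m
    by (auto simp: card_shift_cell_image card_insert_if)
  have "k\<^sup>2 - (k - m)\<^sup>2 = m * m + 2 * (m * (k - m))"
  proof -
    obtain i where "k = m + i" using m by (metis less_imp_add_positive)
    then show ?thesis by (simp add: power2_eq_square algebra_simps)
  qed
  then have "even (k\<^sup>2 - (k - m)\<^sup>2) \<longleftrightarrow> even m" by simp
  then have sign: "(- var_q) ^ (k\<^sup>2 - (k - m)\<^sup>2) = (-1) ^ m * var_q ^ (k\<^sup>2 - (k - m)\<^sup>2)"
    by (cases "even m") auto
  have "extend m k ((D, M), s) = (E, N)" by (simp add: extend_def E_def N_def)
  then have "weight (extend m k ((D, M), s)) =
      (-1) ^ (m + diag (D, M) + (mark (D, M) + (if s then 2 else 0)) div 2)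
      * var_t ^ (mark (D, M) + (if s then 2 else 0))
      * var_q ^ (k\<^sup>2 - (k - m)\<^sup>2 + num_cells (D, M))"
    using cells dia marks by (simp add: weight_def diag_def mark_def num_cells_def)
  also have "\<dots> = (- var_q) ^ (k\<^sup>2 - (k - m)\<^sup>2) * weight (D, M) * (if s then - (var_t\<^sup>2) else 1)"
    unfolding sign weight_def by (cases s) (simp_all only: power_add, simp_all add: mult_ac)
  finally show ?thesis .
qed

text \<open>\<open>extend m k\<close> is a bijection with inverse given by \<open>unshift\<close>
  and the mark at \<open>(m, k)\<close>; summing over the two values of the Boolean produces
  \<open>1 - var_t\<^sup>2\<close>.\<close>

lemma sum_weight_SOP_border:
  assumes m: "1 \<le> m" "m < k"
  shows "sum weight (SOP_border m k) =
    (1 - var_t\<^sup>2) * ((- var_q) ^ (k\<^sup>2 - (k - m)\<^sup>2) * sum weight (SOP (k - m - 1)))"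
proof -
  let ?c = "(- var_q) ^ (k\<^sup>2 - (k - m)\<^sup>2)"
  have "sum weight (SOP_border m k) = (\<Sum>(\<nu>, s)\<in>SOP (k - m - 1) \<times> UNIV.
      ?c * weight \<nu> * (if s then - (var_t\<^sup>2) else 1))"
  proof (rule sum.reindex_bij_witness[where i = "extend m k" and
        j = "\<lambda>\<nu>. ((unshift m (fst \<nu>), unshift m (snd \<nu>)), (m, k) \<in> snd \<nu>)"])
    fix x assume "x \<in> SOP (k - m - 1) \<times> (UNIV :: bool set)"
    then obtain D M s where x: "x = ((D, M), s)" "(D, M) \<in> SOP (k - m - 1)"
      by (metis SigmaE surj_pair)
    obtain E N where ext: "extend m k x = (E, N)" by fastforce
    show "((unshift m (fst (extend m k x)), unshift m (snd (extend m k x))),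
        (m, k) \<in> snd (extend m k x)) = x"
      using unshift_extend[OF m x(2)] ext x(1) by simp
    show "extend m k x \<in> SOP_border m k"
      using extend_in_SOP_border[OF m x(2)] x(1) by simp
  next
    fix \<nu> assume "\<nu> \<in> SOP_border m k"
    then obtain E N where \<nu>: "\<nu> = (E, N)" "(E, N) \<in> SOP_border m k"
      by (metis surj_pair)
    note * = extend_unshift[OF m \<nu>(2)]
    show "extend m k ((unshift m (fst \<nu>), unshift m (snd \<nu>)), (m, k) \<in> snd \<nu>) = \<nu>"
      using * \<nu> by simp
    show "((unshift m (fst \<nu>), unshift m (snd \<nu>)), (m, k) \<in> snd \<nu>) \<in> SOP (k - m - 1) \<times> UNIV"
      using * \<nu> by simp
    show "(case ((unshift m (fst \<nu>), unshift m (snd \<nu>)), (m, k) \<in> snd \<nu>) of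
        (\<nu>, s) \<Rightarrow> ?c * weight \<nu> * (if s then - (var_t\<^sup>2) else 1)) = weight \<nu>"
      using weight_extend[OF m *(1), of "(m, k) \<in> N"] *(2) \<nu> by simp
  qed
  also have "\<dots> = (\<Sum>\<nu>\<in>SOP (k - m - 1). (1 - var_t\<^sup>2) * (?c * weight \<nu>))"
    unfolding sum.cartesian_product[symmetric]
    by (intro sum.cong refl) (simp add: UNIV_bool algebra_simps)
  finally show ?thesis by (simp add: sum_distrib_left)
qed

section \<open>Classification by the height of the last column\<close>

definition SOP_full :: "nat \<Rightarrow> overpartition set" where
  "SOP_full k = {({1..k} \<times> {1..k}, {}), ({1..k} \<times> {1..k}, {(k, k)})}"

text \<open>The diagonal length \<open>k\<close> and the size \<open>k\<^sup>2\<close> have the same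
  parity. Zero marks and one mark both give \<open>mark div 2 = 0\<close>, hence the plus sign in
  \<open>1 + var_t\<close>.\<close>

lemma sum_weight_SOP_full:
  assumes "1 \<le> k"
  shows "sum weight (SOP_full k) = (1 + var_t) * (- var_q) ^ (k\<^sup>2)"
proof -
  have "{i. i \<in> {1..k}} = {1..k}" by auto
  then have "card {i. Suc 0 \<le> i \<and> i \<le> k} = k" by simp
  moreover have "(- var_q) ^ (k\<^sup>2) = (-1) ^ k * var_q ^ (k\<^sup>2)"
    by (cases "even k") auto
  ultimately show ?thesis
    by (simp add: SOP_full_def weight_def diag_def mark_def num_cells_def power2_eq_square
        algebra_simps)
qed

text \<open>The last column is an initial segment, and its height being 0, \<open>k\<close> or some
  \<open>m\<close> strictly between selects the three pieces.\<close>

lemma SOP_decomposition: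
  assumes k: "1 \<le> k"
  shows "SOP k = SOP (k - 1) \<union> (SOP_full k \<union> (\<Union>m\<in>{1..k - 1}. SOP_border m k))"
proof (intro equalityI subsetI)
  fix \<nu> assume "\<nu> \<in> SOP k"
  then obtain D M where \<nu>: "\<nu> = (D, M)" and SOP: "(D, M) \<in> SOP k" by (metis surj_pair)
  have box: "D \<subseteq> {1..k} \<times> {1..k}" using SOP_bounds[OF SOP] by blast
  have dc: "down_closed D" and sym: "\<And>a b. (a, b) \<in> D \<Longrightarrow> (b, a) \<in> D"
    and M: "\<And>a b. (a, b) \<in> M \<Longrightarrow> (a, b) \<in> D \<and> (Suc a, b) \<notin> D \<and> (a, Suc b) \<notin> D \<and> (b, a) \<in> M"
    using SOP by (auto simp: SOP_iff)
  define X where "X = {a. (a, k) \<in> D}"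
  have "X = {1..card X}"
  proof (rule initial_segment_eq_atLeastAtMost_card)
    show "finite X" by (rule finite_subset[of _ "{1..k}"]) (use box in \<open>auto simp: X_def\<close>)
    show "0 \<notin> X" using box by (auto simp: X_def)
    show "y \<in> X" if "x \<in> X" "1 \<le> y" "y \<le> x" for x y
      using that k down_closedD[OF dc, of x k y k] by (auto simp: X_def)
  qed
  then have X: "(a, k) \<in> D \<longleftrightarrow> 1 \<le> a \<and> a \<le> card X" for a
    unfolding X_def by (metis (mono_tags, lifting) atLeastAtMost_iff mem_Collect_eq)
  have "card X \<le> k" using X[of "card X"] box by (cases "card X = 0") auto
  then consider "card X = 0" | "card X = k" | "1 \<le> card X" "card X \<le> k - 1" by linarith
  then show "\<nu> \<in> SOP (k - 1) \<union> (SOP_full k \<union> (\<Union>m\<in>{1..k - 1}. SOP_border m k))"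
  proof cases
    case 1
    \<comment> \<open>By symmetry an empty last column forces an empty last row.\<close>
    have "D \<subseteq> {1..k - 1} \<times> {1..k - 1}"
    proof clarify
      fix a b assume *: "(a, b) \<in> D"
      then have "a \<noteq> k" "b \<noteq> k" using sym[of a b] X[of a] X[of b] 1 by auto
      moreover have "1 \<le> a" "a \<le> k" "1 \<le> b" "b \<le> k" using * box by auto
      ultimately show "a \<in> {1..k - 1} \<and> b \<in> {1..k - 1}" by auto
    qed
    then show ?thesis using SOP by (auto simp: \<nu> SOP_iff)
  next
    case 2
    then have "(k, k) \<in> D" using X k by simp
    then have D: "D = {1..k} \<times> {1..k}"
      using box down_closedD[OF dc, of k k] by auto
    have "M \<subseteq> {(k, k)}"
    proof clarify
      fix a b assume "(a, b) \<in> M"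
      then show "a = k \<and> b = k" using M[of a b] by (auto simp: D)
    qed
    then show ?thesis using D by (auto simp: \<nu> SOP_full_def)
  next
    case 3
    then have "(card X, k) \<in> D" "(Suc (card X), k) \<notin> D" using X by auto
    then show ?thesis using 3 SOP by (auto simp: \<nu> SOP_border_def)
  qed
next
  fix \<nu> assume "\<nu> \<in> SOP (k - 1) \<union> (SOP_full k \<union> (\<Union>m\<in>{1..k - 1}. SOP_border m k))"
  then consider "\<nu> \<in> SOP (k - 1)" | "\<nu> \<in> SOP_full k" | "\<nu> \<in> SOP k"
    by (auto simp: SOP_border_def)
  then show "\<nu> \<in> SOP k"
  proof cases
    case 1
    moreover have "{1..k - 1} \<times> {1..k - 1} \<subseteq> {1..k} \<times> {1..k}" by auto
    ultimately show ?thesis by (auto simp: SOP_def)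
  next
    case 2
    then show ?thesis using k by (auto simp: SOP_full_def SOP_iff down_closed_def)
  qed
qed

text \<open>If \<open>m < m'\<close>, the cell \<open>(m', k)\<close> forces
  \<open>(Suc m, k)\<close> by down-closedness.\<close>

lemma SOP_border_disjoint:
  assumes "m \<noteq> m'" "1 \<le> m" "1 \<le> m'"
  shows "SOP_border m k \<inter> SOP_border m' k = {}"
proof -
  have "SOP_border m k \<inter> SOP_border m' k = {}" if "1 \<le> m" "m < m'" for m m'
  proof -
    have False if "(D, M) \<in> SOP k" "(m', k) \<in> D" "(Suc m, k) \<notin> D" for D M
      using that \<open>m < m'\<close> SOP_bounds(1)[OF that(1)] down_closedD[of D m' k "Suc m" k]
      by (auto simp: SOP_iff)
    then show ?thesis by (force simp: SOP_border_def)
  qed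
  then show ?thesis using assms by (metis Int_commute nat_neq_iff)
qed

section \<open>The recurrence for the weighted sums, and the induction\<close>

lemma sum_weight_SOP_rec:
  assumes k: "1 \<le> k"
  shows "sum weight (SOP k) = sum weight (SOP (k - 1)) + (1 + var_t) * (- var_q) ^ (k\<^sup>2)
     + (1 - var_t\<^sup>2) * (\<Sum>i = 1..k - 1. (- var_q) ^ (k\<^sup>2 - i\<^sup>2) * sum weight (SOP (i - 1)))"
proof -
  let ?B = "\<Union>m\<in>{1..k - 1}. SOP_border m k"
  have fin: "finite (SOP_border m k)" for m
    using finite_SOP[of k] by (simp add: SOP_border_def)
  have small: "(a, k) \<notin> D" if "(D, M) \<in> SOP (k - 1)" for a D M
    using SOP_bounds(1)[OF that] k by auto
  \<comment> \<open>Column \<open>k\<close> is empty in the smaller box and nonempty in every other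
    piece.\<close>
  have "SOP (k - 1) \<inter> (SOP_full k \<union> ?B) = {}"
  proof -
    have "(1, k) \<in> fst \<nu>" if "\<nu> \<in> SOP_full k" for \<nu>
      using that k by (auto simp: SOP_full_def)
    moreover have "\<exists>m. (m, k) \<in> fst \<nu>" if "\<nu> \<in> ?B" for \<nu>
      using that by (auto simp: SOP_border_def)
    moreover have "\<forall>m. (m, k) \<notin> fst \<nu>" if "\<nu> \<in> SOP (k - 1)" for \<nu>
      using that small by (cases \<nu>) auto
    ultimately show ?thesis by blast
  qed
  moreover have "SOP_full k \<inter> ?B = {}"
    using k by (auto simp: SOP_full_def SOP_border_def)
  moreover have "finite (SOP_full k)" by (simp add: SOP_full_def)
  moreover have "finite ?B" using fin by blast
  ultimately have "sum weight (SOP k) =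
      sum weight (SOP (k - 1)) + (sum weight (SOP_full k) + sum weight ?B)"
    unfolding SOP_decomposition[OF k] by (simp add: sum.union_disjoint finite_SOP)
  also have "sum weight ?B = (\<Sum>m = 1..k - 1. sum weight (SOP_border m k))"
    using fin SOP_border_disjoint by (intro sum.UNION_disjoint) auto
  also have "\<dots> = (\<Sum>m = 1..k - 1.
      (1 - var_t\<^sup>2) * ((- var_q) ^ (k\<^sup>2 - (k - m)\<^sup>2) * sum weight (SOP (k - m - 1))))"
    using k by (intro sum.cong refl sum_weight_SOP_border) auto
  \<comment> \<open>The substitution \<open>i = k - m\<close> turns the box size
    \<open>k - m - 1\<close> into the index \<open>i - 1\<close> of the recurrence.\<close>
  also have "\<dots> = (\<Sum>i = 1..k - 1.
      (1 - var_t\<^sup>2) * ((- var_q) ^ (k\<^sup>2 - i\<^sup>2) * sum weight (SOP (i - 1))))"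
    by (rule sum.reindex_bij_witness[where i = "\<lambda>i. k - i" and j = "\<lambda>m. k - m"]) auto
  finally show ?thesis
    using k by (simp add: sum_weight_SOP_full sum_distrib_left)
qed

theorem theorem4p1:
  fixes k :: nat
  shows "T_poly k =
    (\<Sum>\<nu> \<in> SOP k. (-1) ^ (diag \<nu> + mark \<nu> div 2) * var_t ^ mark \<nu> * var_q ^ num_cells \<nu>)"
proof -
  have "T_poly k = sum weight (SOP k)"
  \<comment> \<open>Strong induction is required because the recurrence refers to every index below
    \<open>k - 1\<close> as well as to \<open>k - 1\<close>.\<close>
  proof (induction k rule: less_induct)
    case (less k)
    show ?case
    proof (cases "k = 0")
      case True
      have "(D, M) \<in> SOP 0 \<longleftrightarrow> (D, M) = ({}, {})" for D M
        by (auto simp: SOP_iff down_closed_def)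
      then have "SOP 0 = {({}, {})}" by auto
      then show ?thesis
        using True by (simp add: weight_def diag_def mark_def num_cells_def)
    next
      case False
      then have k: "1 \<le> k" by simp
      have "(\<Sum>i = 1..k - 1. (- var_q) ^ (k\<^sup>2 - i\<^sup>2) * T_poly (i - 1)) =
          (\<Sum>i = 1..k - 1. (- var_q) ^ (k\<^sup>2 - i\<^sup>2) * sum weight (SOP (i - 1)))"
        using less k by (intro sum.cong refl) auto
      then show ?thesis
        unfolding T_poly_rec[OF k] sum_weight_SOP_rec[OF k] using less k by simp
    qed
  qed
  then show ?thesis by (simp add: weight_def)
qed

end
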